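(* Let $R$ be a ring. The following statements hold for the class of IFP left $R$-modules: (1) faithful completely prime modules are closed under taking essential extensions, i.e. if $M$ is an IFP module and $N$ is an essential submodule of $M$ that is a faithful completely prime module, then $M$ is a faithful completely prime module; (2) the faithful completely prime radical $\beta_{co}^f$ is hereditary, i.e. $\beta_{co}^f(N)=N\cap\beta_{co}^f(M)$ for every IFP module $M$ and every submodule $N$ of $M$; (3) the pair $\tau_{\beta_{co}^f}=(\mathcal{T}_{\beta_{co}^f},\mathcal{F}_{\beta_{co}^f})$, where $\mathcal{T}_{\beta_{co}^f}=\{M : M \text{ is an IFP module and } \beta_{co}^f(M)=M\}$ and $\mathcal{F}_{\beta_{co}^f}=\{M : M\text{ is an IFP module and }\beta_{co}^f(M)=\{0\}\}$, is a torsion theory (on the class of IFP modules); (4) the faithful completely prime radical is idempotent, i.e. $\beta_{co}^f(\beta_{co}^f(M))=\beta_{co}^f(M)$ for every IFP module $M$.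
   Context: Rings are associative and unital; modules are left unital modules. A left $R$-module $M$ is IFP (has the insertion-of-factor property) if for all $a\in R$ and $m\in M$, $am=0$ implies $arm=0$ for all $r\in R$. A left $R$-module $M$ with $RM\ne\{0\}$ is completely prime if for all $a\in R$ and $m\in M$, $am=0$ implies $m=0$ or $aM=\{0\}$. $M$ is faithful if $\{r\in R: rM=\{0\}\}=\{0\}$. The faithful completely prime radical is $\beta_{co}^f(M)=\bigcap\{N\le M : M/N \text{ is a faithful completely prime module}\}$, with $\beta_{co}^f(M)=M$ if there is no such $N$. A pair $(\mathcal{T},\mathcal{F})$ of classes of modules is a torsion theory on a class $\mathcal{C}$ of modules (with $\mathcal{T},\mathcal{F}\subseteq\mathcal{C}$) if: (i) $\mathrm{Hom}_R(T,F)=\{0\}$ for all $T\in\mathcal{T}$, $F\in\mathcal{F}$; (ii) if $C\in\mathcal{C}$ and $\mathrm{Hom}_R(C,F)=\{0\}$ for all $F\in\mathcal{F}$, then $C\in\mathcal{T}$; (iii) if $C\in\mathcal{C}$ and $\mathrm{Hom}_R(T,C)=\{0\}$ for all $T\in\mathcal{T}$, then $C\in\mathcal{F}$. *)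

theory Defs
  imports "HOL-Algebra.Module" "HOL-Algebra.QuotRing"
begin

text \<open>
  The library locale \<open>module\<close> requires a commutative base ring; the following has the
  same axioms over an arbitrary associative unital ring.  It reuses the record type
  \<open>('r, 'm) module\<close>, whose fields \<open>mult\<close> and \<open>one\<close> (inherited from rings) carry no
  meaning for a module and are never constrained or used.
\<close>

locale left_module = R?: ring R + M?: abelian_group M
  for R (structure) and M (structure) +
  assumes smult_closed:
      "\<lbrakk>a \<in> carrier R; x \<in> carrier M\<rbrakk> \<Longrightarrow> a \<odot>\<^bsub>M\<^esub> x \<in> carrier M"
    and smult_l_distr:
      "\<lbrakk>a \<in> carrier R; b \<in> carrier R; x \<in> carrier M\<rbrakk> \<Longrightarrow>
        (a \<oplus>\<^bsub>R\<^esub> b) \<odot>\<^bsub>M\<^esub> x = a \<odot>\<^bsub>M\<^esub> x \<oplus>\<^bsub>M\<^esub> b \<odot>\<^bsub>M\<^esub> x"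
    and smult_r_distr:
      "\<lbrakk>a \<in> carrier R; x \<in> carrier M; y \<in> carrier M\<rbrakk> \<Longrightarrow>
        a \<odot>\<^bsub>M\<^esub> (x \<oplus>\<^bsub>M\<^esub> y) = a \<odot>\<^bsub>M\<^esub> x \<oplus>\<^bsub>M\<^esub> a \<odot>\<^bsub>M\<^esub> y"
    and smult_assoc1:
      "\<lbrakk>a \<in> carrier R; b \<in> carrier R; x \<in> carrier M\<rbrakk> \<Longrightarrow>
        (a \<otimes>\<^bsub>R\<^esub> b) \<odot>\<^bsub>M\<^esub> x = a \<odot>\<^bsub>M\<^esub> (b \<odot>\<^bsub>M\<^esub> x)"
    and smult_one:
      "x \<in> carrier M \<Longrightarrow> \<one>\<^bsub>R\<^esub> \<odot>\<^bsub>M\<^esub> x = x"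

text \<open>Library predicate \<open>submodule N R M\<close> does not presuppose commutativity of \<open>R\<close>.\<close>

abbreviation submod :: "('r, 'm) module \<Rightarrow> 'm set \<Rightarrow> ('r, 'm) module" where
  "submod M N \<equiv> M\<lparr>carrier := N\<rparr>"

definition quot_module :: "('r, 'm) module \<Rightarrow> 'm set \<Rightarrow> ('r, 'm set) module" where
  "quot_module M N =
    \<lparr>carrier = a_rcosets\<^bsub>M\<^esub> N, mult = undefined, one = undefined,
     zero = N, add = set_add M,
     smult = (\<lambda>r X. \<Union>x\<in>X. N +>\<^bsub>M\<^esub> (r \<odot>\<^bsub>M\<^esub> x))\<rparr>"

definition ifp_module :: "'r ring \<Rightarrow> ('r, 'm) module \<Rightarrow> bool" where
  "ifp_module R M \<longleftrightarrow> left_module R M \<and>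
    (\<forall>a\<in>carrier R. \<forall>m\<in>carrier M. a \<odot>\<^bsub>M\<^esub> m = \<zero>\<^bsub>M\<^esub> \<longrightarrow>
      (\<forall>r\<in>carrier R. (a \<otimes>\<^bsub>R\<^esub> r) \<odot>\<^bsub>M\<^esub> m = \<zero>\<^bsub>M\<^esub>))"

definition completely_prime_module :: "'r ring \<Rightarrow> ('r, 'm) module \<Rightarrow> bool" where
  "completely_prime_module R M \<longleftrightarrow> left_module R M \<and>
    {r \<odot>\<^bsub>M\<^esub> m |r m. r \<in> carrier R \<and> m \<in> carrier M} \<noteq> {\<zero>\<^bsub>M\<^esub>} \<and>
    (\<forall>a\<in>carrier R. \<forall>m\<in>carrier M. a \<odot>\<^bsub>M\<^esub> m = \<zero>\<^bsub>M\<^esub> \<longrightarrow>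
      m = \<zero>\<^bsub>M\<^esub> \<or> {a \<odot>\<^bsub>M\<^esub> x |x. x \<in> carrier M} = {\<zero>\<^bsub>M\<^esub>})"

definition faithful_module :: "'r ring \<Rightarrow> ('r, 'm) module \<Rightarrow> bool" where
  "faithful_module R M \<longleftrightarrow> left_module R M \<and>
    {r \<in> carrier R. {r \<odot>\<^bsub>M\<^esub> m |m. m \<in> carrier M} = {\<zero>\<^bsub>M\<^esub>}} = {\<zero>\<^bsub>R\<^esub>}"

definition faithful_completely_prime :: "'r ring \<Rightarrow> ('r, 'm) module \<Rightarrow> bool" where
  "faithful_completely_prime R M \<longleftrightarrow> faithful_module R M \<and> completely_prime_module R M"

definition beta_cof :: "'r ring \<Rightarrow> ('r, 'm) module \<Rightarrow> 'm set" where
  "beta_cof R M =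
    (let \<N> = {N. submodule N R M \<and> faithful_completely_prime R (quot_module M N)}
     in if \<N> = {} then carrier M else \<Inter>\<N>)"

definition essential_submodule :: "'m set \<Rightarrow> 'r ring \<Rightarrow> ('r, 'm) module \<Rightarrow> bool" where
  "essential_submodule N R M \<longleftrightarrow> submodule N R M \<and>
    (\<forall>K. submodule K R M \<and> K \<noteq> {\<zero>\<^bsub>M\<^esub>} \<longrightarrow> N \<inter> K \<noteq> {\<zero>\<^bsub>M\<^esub>})"

text \<open>Homomorphisms are extensional, so that a homomorphism is determined by its values on
  the carrier and the trivial Hom set is a singleton.\<close>

definition Hom :: "'r ring \<Rightarrow> ('r, 'm) module \<Rightarrow> ('r, 'n) module \<Rightarrow> ('m \<Rightarrow> 'n) set" where
  "Hom R M N = {h \<in> carrier M \<rightarrow>\<^sub>E carrier N.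
    (\<forall>x\<in>carrier M. \<forall>y\<in>carrier M. h (x \<oplus>\<^bsub>M\<^esub> y) = h x \<oplus>\<^bsub>N\<^esub> h y) \<and>
    (\<forall>r\<in>carrier R. \<forall>x\<in>carrier M. h (r \<odot>\<^bsub>M\<^esub> x) = r \<odot>\<^bsub>N\<^esub> h x)}"

definition Hom_trivial :: "'r ring \<Rightarrow> ('r, 'm) module \<Rightarrow> ('r, 'n) module \<Rightarrow> bool" where
  "Hom_trivial R M N \<longleftrightarrow> Hom R M N = {\<lambda>x\<in>carrier M. \<zero>\<^bsub>N\<^esub>}"

text \<open>
  A class of modules is a set of modules whose carriers are subsets of one type \<open>'m\<close>.
  The type \<open>'m\<close> plays the role of a universe: it is arbitrary, and up to isomorphism
  the modules inside it are closed under submodules and quotients.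
\<close>

definition torsion_theory ::
  "'r ring \<Rightarrow> ('r, 'm) module set \<Rightarrow> ('r, 'm) module set \<Rightarrow> ('r, 'm) module set \<Rightarrow> bool" where
  "torsion_theory R \<C> \<T> \<F> \<longleftrightarrow> \<T> \<subseteq> \<C> \<and> \<F> \<subseteq> \<C> \<and>
    (\<forall>T\<in>\<T>. \<forall>F\<in>\<F>. Hom_trivial R T F) \<and>
    (\<forall>C\<in>\<C>. (\<forall>F\<in>\<F>. Hom_trivial R C F) \<longrightarrow> C \<in> \<T>) \<and>
    (\<forall>C\<in>\<C>. (\<forall>T\<in>\<T>. Hom_trivial R T C) \<longrightarrow> C \<in> \<F>)"

definition torsion_class :: "'r ring \<Rightarrow> ('r, 'm) module set" where
  "torsion_class R = {M. ifp_module R M \<and> beta_cof R M = carrier M}"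

definition torsion_free_class :: "'r ring \<Rightarrow> ('r, 'm) module set" where
  "torsion_free_class R = {M. ifp_module R M \<and> beta_cof R M = {\<zero>\<^bsub>M\<^esub>}}"

end

theory Submission
  imports Defs
begin

text \<open>
  A module is faithful completely prime iff it is nonzero and \<open>a m = 0\<close> forces \<open>a = 0\<close> or
  \<open>m = 0\<close>.  If such a module exists, \<open>R\<close> has no zero divisors; hence over every other ring the
  radical is the identity.  If \<open>R\<close> has no zero divisors, then the elements of an IFP module \<open>M\<close>
  killed by some nonzero scalar form a submodule (\<open>b m = 0\<close> and \<open>c n = 0\<close> give
  \<open>(b c) (m + n) = 0\<close>, so no Ore condition is needed), the quotient by it has no torsion, and
  the radical is exactly this torsion submodule.  This description also avoids the problem that
  quotients of IFP modules need not be IFP.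
\<close>

section \<open>Modules over noncommutative rings\<close>

lemma (in left_module) smult_l_null:
  assumes "x \<in> carrier M" shows "\<zero> \<odot>\<^bsub>M\<^esub> x = \<zero>\<^bsub>M\<^esub>"
proof -
  have "\<zero> \<odot>\<^bsub>M\<^esub> x = \<zero> \<odot>\<^bsub>M\<^esub> x \<oplus>\<^bsub>M\<^esub> \<zero> \<odot>\<^bsub>M\<^esub> x"
    using smult_l_distr[of \<zero> \<zero> x] assms by simp
  then show ?thesis
    using smult_closed[OF R.zero_closed assms] by (metis M.add.r_cancel_one')
qed

lemma (in left_module) smult_r_null:
  assumes "a \<in> carrier R" shows "a \<odot>\<^bsub>M\<^esub> \<zero>\<^bsub>M\<^esub> = \<zero>\<^bsub>M\<^esub>"
proof -
  have "a \<odot>\<^bsub>M\<^esub> \<zero>\<^bsub>M\<^esub> = a \<odot>\<^bsub>M\<^esub> \<zero>\<^bsub>M\<^esub> \<oplus>\<^bsub>M\<^esub> a \<odot>\<^bsub>M\<^esub> \<zero>\<^bsub>M\<^esub>"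
    using smult_r_distr[of a "\<zero>\<^bsub>M\<^esub>" "\<zero>\<^bsub>M\<^esub>"] assms by simp
  then show ?thesis
    using smult_closed[OF assms M.zero_closed] by (metis M.add.r_cancel_one')
qed

lemma (in left_module) smult_l_minus_one:
  assumes "x \<in> carrier M" shows "(\<ominus> \<one>) \<odot>\<^bsub>M\<^esub> x = \<ominus>\<^bsub>M\<^esub> x"
proof -
  have "(\<ominus> \<one>) \<odot>\<^bsub>M\<^esub> x \<oplus>\<^bsub>M\<^esub> x = \<zero>\<^bsub>M\<^esub>"
    using smult_l_distr[of "\<ominus> \<one>" \<one> x] assms by (simp add: smult_one R.l_neg smult_l_null)
  then show ?thesis
    using assms by (simp add: M.minus_equality smult_closed)
qed

text \<open>Closure under negation comes from closure under scalars, as the inverse of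
  \<open>x\<close> is \<open>x\<close> multiplied by -1.\<close>

lemma (in left_module) submoduleI:
  assumes "H \<subseteq> carrier M" and "\<zero>\<^bsub>M\<^esub> \<in> H"
    and "\<And>a b. \<lbrakk>a \<in> H; b \<in> H\<rbrakk> \<Longrightarrow> a \<oplus>\<^bsub>M\<^esub> b \<in> H"
    and "\<And>a x. \<lbrakk>a \<in> carrier R; x \<in> H\<rbrakk> \<Longrightarrow> a \<odot>\<^bsub>M\<^esub> x \<in> H"
  shows "submodule H R M"
proof -
  have "\<ominus>\<^bsub>M\<^esub> x \<in> H" if "x \<in> H" for x
    using that assms smult_l_minus_one[of x] by (metis R.a_inv_closed R.one_closed subsetD)
  then show ?thesis
    using assms by (intro submodule.intro subgroup.intro submodule_axioms.intro)
      (auto simp: a_inv_def)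
qed

lemma (in left_module) submoduleD:
  assumes "submodule H R M"
  shows "H \<subseteq> carrier M" and "\<zero>\<^bsub>M\<^esub> \<in> H"
    and "\<And>x. x \<in> H \<Longrightarrow> \<ominus>\<^bsub>M\<^esub> x \<in> H"
    and "\<And>x y. \<lbrakk>x \<in> H; y \<in> H\<rbrakk> \<Longrightarrow> x \<oplus>\<^bsub>M\<^esub> y \<in> H"
    and "\<And>a x. \<lbrakk>a \<in> carrier R; x \<in> H\<rbrakk> \<Longrightarrow> a \<odot>\<^bsub>M\<^esub> x \<in> H"
proof -
  note H = submodule.axioms(1)[OF assms]
  show "H \<subseteq> carrier M" "\<zero>\<^bsub>M\<^esub> \<in> H" "\<And>x y. \<lbrakk>x \<in> H; y \<in> H\<rbrakk> \<Longrightarrow> x \<oplus>\<^bsub>M\<^esub> y \<in> H"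
    using subgroup.subset[OF H] subgroup.one_closed[OF H] subgroup.m_closed[OF H] by auto
  show "\<And>x. x \<in> H \<Longrightarrow> \<ominus>\<^bsub>M\<^esub> x \<in> H"
    using subgroup.m_inv_closed[OF H] by (simp add: a_inv_def)
  show "\<And>a x. \<lbrakk>a \<in> carrier R; x \<in> H\<rbrakk> \<Longrightarrow> a \<odot>\<^bsub>M\<^esub> x \<in> H"
    by (rule submodule.smult_closed[OF assms])
qed

lemma (in left_module) submodule_abelian_subgroup:
  assumes "submodule H R M"
  shows "abelian_subgroup H M"
  using submodule.axioms(1)[OF assms] M.abelian_group_axioms
  by (intro abelian_subgroupI3 additive_subgroup.intro)

text \<open>The axioms pass along a surjection that respects the operations. This serves both the
  quotient by cosets and its copy on coset representatives.\<close>

lemma (in left_module) left_module_image: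
  fixes Q (structure)
  assumes carrier: "carrier Q = f ` carrier M"
    and zero: "\<zero>\<^bsub>Q\<^esub> = f \<zero>\<^bsub>M\<^esub>"
    and add: "\<And>x y. \<lbrakk>x \<in> carrier M; y \<in> carrier M\<rbrakk> \<Longrightarrow> f x \<oplus>\<^bsub>Q\<^esub> f y = f (x \<oplus>\<^bsub>M\<^esub> y)"
    and smult: "\<And>a x. \<lbrakk>a \<in> carrier R; x \<in> carrier M\<rbrakk> \<Longrightarrow> a \<odot>\<^bsub>Q\<^esub> f x = f (a \<odot>\<^bsub>M\<^esub> x)"
  shows "left_module R Q"
proof -
  have "abelian_group Q"
  proof (rule abelian_groupI)
    fix x assume "x \<in> carrier Q"
    then obtain u where u: "u \<in> carrier M" "x = f u" using carrier by auto
    then show "\<exists>y\<in>carrier Q. y \<oplus>\<^bsub>Q\<^esub> x = \<zero>\<^bsub>Q\<^esub>"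
      by (intro bexI[of _ "f (\<ominus>\<^bsub>M\<^esub> u)"]) (auto simp: add zero carrier M.l_neg)
  qed (auto simp: carrier add zero M.a_ac)
  then show ?thesis
    by (intro left_module.intro left_module_axioms.intro R.ring_axioms)
      (auto simp: carrier add smult smult_closed smult_l_distr smult_r_distr smult_assoc1 smult_one)
qed

lemma (in left_module) left_module_submod:
  assumes "submodule N R M"
  shows "left_module R (M\<lparr>carrier := N\<rparr>)"
proof -
  note N = submoduleD[OF assms]
  have c: "x \<in> carrier M" if "x \<in> N" for x using N(1) that by auto
  have "abelian_group (M\<lparr>carrier := N\<rparr>)"
  proof (rule abelian_groupI)
    fix x assume "x \<in> carrier (M\<lparr>carrier := N\<rparr>)"
    then show "\<exists>y\<in>carrier (M\<lparr>carrier := N\<rparr>).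
        y \<oplus>\<^bsub>M\<lparr>carrier := N\<rparr>\<^esub> x = \<zero>\<^bsub>M\<lparr>carrier := N\<rparr>\<^esub>"
      by (intro bexI[of _ "\<ominus>\<^bsub>M\<^esub> x"]) (auto simp: N c M.l_neg)
  qed (auto simp: N c M.a_ac)
  then show ?thesis
    by (intro left_module.intro left_module_axioms.intro R.ring_axioms)
      (auto simp: N c smult_l_distr smult_r_distr smult_assoc1 smult_one)
qed

lemma ifp_moduleD:
  assumes "ifp_module R M"
  shows "left_module R M"
    and "\<lbrakk>a \<in> carrier R; r \<in> carrier R; m \<in> carrier M; a \<odot>\<^bsub>M\<^esub> m = \<zero>\<^bsub>M\<^esub>\<rbrakk>
      \<Longrightarrow> (a \<otimes>\<^bsub>R\<^esub> r) \<odot>\<^bsub>M\<^esub> m = \<zero>\<^bsub>M\<^esub>"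
  using assms by (auto simp: ifp_module_def)

lemma ifp_module_submod:
  assumes "ifp_module R M" and "submodule N R M"
  shows "ifp_module R (submod M N)"
proof -
  interpret M: left_module R M by (rule ifp_moduleD[OF assms(1)])
  show ?thesis
    using assms(1) M.left_module_submod[OF assms(2)] M.submoduleD(1)[OF assms(2)]
    by (auto simp: ifp_module_def)
qed


section \<open>Torsion\<close>

text \<open>In general only a set. Over the zero ring there is no nonzero scalar and the set is
  empty, so torsion-freeness is expressed by inclusion in the zero set and not by equality.\<close>

definition torsion_part :: "'r ring \<Rightarrow> ('r, 'm) module \<Rightarrow> 'm set" where
  "torsion_part R M =
    {m \<in> carrier M. \<exists>a\<in>carrier R. a \<noteq> \<zero>\<^bsub>R\<^esub> \<and> a \<odot>\<^bsub>M\<^esub> m = \<zero>\<^bsub>M\<^esub>}"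

definition no_zero_divisors :: "'r ring \<Rightarrow> bool" where
  "no_zero_divisors R \<longleftrightarrow> \<one>\<^bsub>R\<^esub> \<noteq> \<zero>\<^bsub>R\<^esub> \<and>
    (\<forall>a\<in>carrier R. \<forall>b\<in>carrier R. a \<otimes>\<^bsub>R\<^esub> b = \<zero>\<^bsub>R\<^esub> \<longrightarrow> a = \<zero>\<^bsub>R\<^esub> \<or> b = \<zero>\<^bsub>R\<^esub>)"

text \<open>Complete primeness turns \<open>a m = 0\<close> with \<open>m\<close> nonzero into
  \<open>a M = 0\<close>, and faithfulness then gives \<open>a = 0\<close>. Conversely, one nonzero
  element is killed by no nonzero scalar, which gives faithfulness, and \<open>R M = M\<close>
  because \<open>M\<close> is unital.\<close>

lemma faithful_completely_prime_iff:
  fixes R :: "'r ring" (structure) and M :: "('r, 'm) module" (structure)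
  assumes "left_module R M"
  shows "faithful_completely_prime R M \<longleftrightarrow>
    carrier M \<noteq> {\<zero>\<^bsub>M\<^esub>} \<and> torsion_part R M \<subseteq> {\<zero>\<^bsub>M\<^esub>}"
proof -
  interpret left_module R M by (rule assms)
  have RM: "{r \<odot>\<^bsub>M\<^esub> m |r m. r \<in> carrier R \<and> m \<in> carrier M} = carrier M"
    using smult_closed smult_one by (auto, metis R.one_closed)
  have ann: "{a \<odot>\<^bsub>M\<^esub> x |x. x \<in> carrier M} = {\<zero>\<^bsub>M\<^esub>} \<longleftrightarrow> (\<forall>x\<in>carrier M. a \<odot>\<^bsub>M\<^esub> x = \<zero>\<^bsub>M\<^esub>)" for a
    unfolding Setcompr_eq_image by (auto simp: set_eq_iff image_iff) (blast intro: M.zero_closed)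
  show ?thesis
  proof
    assume fcp: "faithful_completely_prime R M"
    then have faithful: "a = \<zero>" if "a \<in> carrier R" "\<forall>x\<in>carrier M. a \<odot>\<^bsub>M\<^esub> x = \<zero>\<^bsub>M\<^esub>" for a
      using that unfolding faithful_completely_prime_def faithful_module_def ann by blast
    have tf: "m = \<zero>\<^bsub>M\<^esub> \<or> (\<forall>x\<in>carrier M. a \<odot>\<^bsub>M\<^esub> x = \<zero>\<^bsub>M\<^esub>)"
      if "a \<in> carrier R" "m \<in> carrier M" "a \<odot>\<^bsub>M\<^esub> m = \<zero>\<^bsub>M\<^esub>" for a m
      using fcp that unfolding faithful_completely_prime_def completely_prime_module_def ann by blast
    have "carrier M \<noteq> {\<zero>\<^bsub>M\<^esub>}"
      using fcp unfolding faithful_completely_prime_def completely_prime_module_def RM by blast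
    moreover have "x = \<zero>\<^bsub>M\<^esub>" if "x \<in> torsion_part R M" for x
      using that tf faithful unfolding torsion_part_def by blast
    ultimately show "carrier M \<noteq> {\<zero>\<^bsub>M\<^esub>} \<and> torsion_part R M \<subseteq> {\<zero>\<^bsub>M\<^esub>}"
      by blast
  next
    assume *: "carrier M \<noteq> {\<zero>\<^bsub>M\<^esub>} \<and> torsion_part R M \<subseteq> {\<zero>\<^bsub>M\<^esub>}"
    then obtain x where x: "x \<in> carrier M" "x \<noteq> \<zero>\<^bsub>M\<^esub>" using M.zero_closed by blast
    have tf: "a = \<zero> \<or> m = \<zero>\<^bsub>M\<^esub>" if "a \<in> carrier R" "m \<in> carrier M" "a \<odot>\<^bsub>M\<^esub> m = \<zero>\<^bsub>M\<^esub>" for a m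
      using * that by (auto simp: torsion_part_def)
    have "faithful_module R M"
      unfolding faithful_module_def ann using assms tf x smult_l_null by auto
    moreover have "completely_prime_module R M"
      unfolding completely_prime_module_def RM ann using assms * tf smult_l_null by auto
    ultimately show "faithful_completely_prime R M"
      by (simp add: faithful_completely_prime_def)
  qed
qed

text \<open>For a fixed nonzero \<open>x\<close>, a product \<open>a b = 0\<close> gives
  \<open>a (b x) = 0\<close>, and cancelling twice leaves \<open>a = 0\<close> or
  \<open>b = 0\<close>.\<close>

lemma faithful_completely_prime_no_zero_divisors:
  fixes R :: "'r ring" (structure) and M :: "('r, 'm) module" (structure)
  assumes "faithful_completely_prime R M"
  shows "no_zero_divisors R"
proof -
  have lm: "left_module R M"
    using assms by (simp add: faithful_completely_prime_def faithful_module_def)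
  then interpret left_module R M .
  from assms lm have M: "carrier M \<noteq> {\<zero>\<^bsub>M\<^esub>}" "torsion_part R M \<subseteq> {\<zero>\<^bsub>M\<^esub>}"
    by (auto simp: faithful_completely_prime_iff)
  then obtain x where x: "x \<in> carrier M" "x \<noteq> \<zero>\<^bsub>M\<^esub>" using M.zero_closed by blast
  have tf: "a = \<zero> \<or> m = \<zero>\<^bsub>M\<^esub>" if "a \<in> carrier R" "m \<in> carrier M" "a \<odot>\<^bsub>M\<^esub> m = \<zero>\<^bsub>M\<^esub>" for a m
    using M(2) that by (auto simp: torsion_part_def)
  show ?thesis
    unfolding no_zero_divisors_def
  proof (intro conjI ballI impI)
    show "\<one> \<noteq> \<zero>" using x smult_one[of x] smult_l_null[of x] by auto
    fix a b assume ab: "a \<in> carrier R" "b \<in> carrier R" "a \<otimes> b = \<zero>"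
    then have "a \<odot>\<^bsub>M\<^esub> (b \<odot>\<^bsub>M\<^esub> x) = \<zero>\<^bsub>M\<^esub>"
      using x by (simp add: smult_assoc1[symmetric] smult_l_null)
    then show "a = \<zero> \<or> b = \<zero>" using tf ab x smult_closed by metis
  qed
qed

text \<open>Torsion in \<open>Q\<close> is read off in \<open>M\<close>: a scalar \<open>a\<close>
  kills \<open>f m\<close> exactly when \<open>a m\<close> lies in \<open>N\<close>, the zero fibre
  of \<open>f\<close>.\<close>

lemma torsion_part_image:
  fixes R :: "'r ring" (structure) and M :: "('r, 'm) module" (structure)
  assumes "left_module R M" and "carrier Q = f ` carrier M"
    and "\<And>a x. \<lbrakk>a \<in> carrier R; x \<in> carrier M\<rbrakk> \<Longrightarrow> a \<odot>\<^bsub>Q\<^esub> f x = f (a \<odot>\<^bsub>M\<^esub> x)"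
    and "\<And>x. x \<in> carrier M \<Longrightarrow> f x = \<zero>\<^bsub>Q\<^esub> \<longleftrightarrow> x \<in> N"
  shows "torsion_part R Q \<subseteq> {\<zero>\<^bsub>Q\<^esub>} \<longleftrightarrow>
    (\<forall>a\<in>carrier R. \<forall>m\<in>carrier M. a \<odot>\<^bsub>M\<^esub> m \<in> N \<longrightarrow> a = \<zero> \<or> m \<in> N)"
proof -
  interpret left_module R M by (rule assms)
  have "m \<in> N" if "torsion_part R Q \<subseteq> {\<zero>\<^bsub>Q\<^esub>}" "a \<in> carrier R" "m \<in> carrier M"
      "a \<odot>\<^bsub>M\<^esub> m \<in> N" "a \<noteq> \<zero>" for a m
  proof -
    have "a \<odot>\<^bsub>Q\<^esub> f m = \<zero>\<^bsub>Q\<^esub>" using assms(3,4) that smult_closed by simp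
    then have "f m \<in> torsion_part R Q" using assms(2) that by (auto simp: torsion_part_def)
    then show ?thesis using assms(4) that by blast
  qed
  moreover have "torsion_part R Q \<subseteq> {\<zero>\<^bsub>Q\<^esub>}"
    if *: "\<And>a m. \<lbrakk>a \<in> carrier R; m \<in> carrier M; a \<odot>\<^bsub>M\<^esub> m \<in> N\<rbrakk> \<Longrightarrow> a = \<zero> \<or> m \<in> N"
  proof
    fix x assume "x \<in> torsion_part R Q"
    then obtain m a where "m \<in> carrier M" "x = f m" "a \<in> carrier R" "a \<noteq> \<zero>" "a \<odot>\<^bsub>Q\<^esub> f m = \<zero>\<^bsub>Q\<^esub>"
      using assms(2) by (auto simp: torsion_part_def)
    then show "x \<in> {\<zero>\<^bsub>Q\<^esub>}" using *[of a m] assms(3,4) smult_closed by auto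
  qed
  ultimately show ?thesis by blast
qed

text \<open>The coset map pulls both conditions of \<open>faithful_completely_prime_iff\<close> back
  to \<open>M\<close>, so that the radical can be studied without computing in
  \<open>quot_module\<close>.\<close>

lemma faithful_completely_prime_quot_iff:
  fixes R :: "'r ring" (structure) and M :: "('r, 'm) module" (structure)
  assumes "left_module R M" and "submodule N R M"
  shows "faithful_completely_prime R (quot_module M N) \<longleftrightarrow> N \<noteq> carrier M \<and>
    (\<forall>a\<in>carrier R. \<forall>m\<in>carrier M. a \<odot>\<^bsub>M\<^esub> m \<in> N \<longrightarrow> a = \<zero> \<or> m \<in> N)"
proof -
  note lm = assms(1)
  interpret left_module R M by (rule lm)
  interpret N: abelian_subgroup N M by (rule submodule_abelian_subgroup[OF assms(2)])
  note N = submoduleD[OF assms(2)]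
  let ?Q = "quot_module M N" and ?f = "\<lambda>x. N +>\<^bsub>M\<^esub> x"
  have carrier: "carrier ?Q = ?f ` carrier M"
    by (auto simp: quot_module_def A_RCOSETS_def')
  have zero: "\<zero>\<^bsub>?Q\<^esub> = ?f \<zero>\<^bsub>M\<^esub>"
    using N(1) by (simp add: quot_module_def)
  have add: "?f x \<oplus>\<^bsub>?Q\<^esub> ?f y = ?f (x \<oplus>\<^bsub>M\<^esub> y)" if "x \<in> carrier M" "y \<in> carrier M" for x y
    using that by (simp add: quot_module_def N.a_rcos_sum)
  have smult: "a \<odot>\<^bsub>?Q\<^esub> ?f x = ?f (a \<odot>\<^bsub>M\<^esub> x)" if a: "a \<in> carrier R" and x: "x \<in> carrier M" for a x
  proof -
    \<comment> \<open>\<open>quot_module\<close> scales a coset by uniting the cosets of all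
      \<open>a y\<close>. Each \<open>a y\<close> lies in the coset of \<open>a x\<close>, so the
      united cosets coincide.\<close>
    have "?f (a \<odot>\<^bsub>M\<^esub> y) = ?f (a \<odot>\<^bsub>M\<^esub> x)" if y: "y \<in> ?f x" for y
    proof -
      from y obtain n where n: "n \<in> N" "y = n \<oplus>\<^bsub>M\<^esub> x" by (auto simp: a_r_coset_def')
      then have "a \<odot>\<^bsub>M\<^esub> y = a \<odot>\<^bsub>M\<^esub> n \<oplus>\<^bsub>M\<^esub> a \<odot>\<^bsub>M\<^esub> x"
        using a x N(1) by (auto simp: smult_r_distr)
      then have "a \<odot>\<^bsub>M\<^esub> y \<in> ?f (a \<odot>\<^bsub>M\<^esub> x)"
        using N(5)[OF a n(1)] by (auto simp: a_r_coset_def')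
      then show ?thesis using N.a_repr_independence' smult_closed[OF a x] by simp
    qed
    then have "(\<Union>y\<in>?f x. ?f (a \<odot>\<^bsub>M\<^esub> y)) = (\<Union>y\<in>?f x. ?f (a \<odot>\<^bsub>M\<^esub> x))"
      by (rule SUP_cong[OF refl])
    \<comment> \<open>The index set contains \<open>x\<close>, so the union of the constant family
      is not empty.\<close>
    also have "\<dots> = ?f (a \<odot>\<^bsub>M\<^esub> x)"
      using N.a_rcos_self[OF x] by blast
    finally show ?thesis by (simp add: quot_module_def)
  qed
  have ker: "?f x = \<zero>\<^bsub>?Q\<^esub> \<longleftrightarrow> x \<in> N" if "x \<in> carrier M" for x
    using N.a_rcos_self[OF that] N.a_rcos_const[of x] unfolding quot_module_def by auto
  have "carrier ?Q = {\<zero>\<^bsub>?Q\<^esub>} \<longleftrightarrow> (\<forall>x\<in>carrier M. ?f x = \<zero>\<^bsub>?Q\<^esub>)"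
    unfolding carrier using zero M.zero_closed by blast
  also have "\<dots> \<longleftrightarrow> N = carrier M" using ker N(1) by blast
  finally have trivial: "carrier ?Q = {\<zero>\<^bsub>?Q\<^esub>} \<longleftrightarrow> N = carrier M" .
  have lmQ: "left_module R ?Q" by (rule left_module_image[OF carrier zero add smult])
  have "torsion_part R ?Q \<subseteq> {\<zero>\<^bsub>?Q\<^esub>} \<longleftrightarrow>
      (\<forall>a\<in>carrier R. \<forall>m\<in>carrier M. a \<odot>\<^bsub>M\<^esub> m \<in> N \<longrightarrow> a = \<zero> \<or> m \<in> N)"
    by (rule torsion_part_image[OF lm carrier smult ker])
  with faithful_completely_prime_iff[OF lmQ] trivial show ?thesis by metis
qed

text \<open>The annihilator of an element is in general only a left ideal. IFP makes it two-sided,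
  which replaces commutativity in the closure under sums and scalars.\<close>

lemma submodule_torsion_part:
  fixes R :: "'r ring" (structure) and M :: "('r, 'm) module" (structure)
  assumes "ifp_module R M" and "no_zero_divisors R"
  shows "submodule (torsion_part R M) R M"
proof -
  note ifp = ifp_moduleD(2)[OF assms(1)]
  interpret left_module R M by (rule ifp_moduleD[OF assms(1)])
  have one: "\<one> \<noteq> \<zero>" and nzd: "\<And>a b. \<lbrakk>a \<in> carrier R; b \<in> carrier R; a \<noteq> \<zero>; b \<noteq> \<zero>\<rbrakk> \<Longrightarrow> a \<otimes> b \<noteq> \<zero>"
    using assms(2) by (auto simp: no_zero_divisors_def)
  show ?thesis
  proof (rule submoduleI)
    show "torsion_part R M \<subseteq> carrier M" by (auto simp: torsion_part_def)
    show "\<zero>\<^bsub>M\<^esub> \<in> torsion_part R M"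
      using one smult_one by (auto simp: torsion_part_def)
  next
    fix m n assume "m \<in> torsion_part R M" "n \<in> torsion_part R M"
    then obtain b c where *: "m \<in> carrier M" "b \<in> carrier R" "b \<noteq> \<zero>" "b \<odot>\<^bsub>M\<^esub> m = \<zero>\<^bsub>M\<^esub>"
      "n \<in> carrier M" "c \<in> carrier R" "c \<noteq> \<zero>" "c \<odot>\<^bsub>M\<^esub> n = \<zero>\<^bsub>M\<^esub>"
      by (auto simp: torsion_part_def)
    \<comment> \<open>The summand with \<open>n\<close> is regrouped to use \<open>c n = 0\<close>;
      the one with \<open>m\<close> keeps the product \<open>b c\<close>, so that IFP applies to
      \<open>b m = 0\<close>.\<close>
    then have "(b \<otimes> c) \<odot>\<^bsub>M\<^esub> (m \<oplus>\<^bsub>M\<^esub> n) = (b \<otimes> c) \<odot>\<^bsub>M\<^esub> m \<oplus>\<^bsub>M\<^esub> b \<odot>\<^bsub>M\<^esub> (c \<odot>\<^bsub>M\<^esub> n)"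
      by (simp add: smult_r_distr smult_assoc1)
    also have "\<dots> = \<zero>\<^bsub>M\<^esub>"
      using ifp[of b c m] * by (simp add: smult_r_null)
    finally show "m \<oplus>\<^bsub>M\<^esub> n \<in> torsion_part R M"
      using * nzd[of b c] by (auto simp: torsion_part_def intro!: bexI[of _ "b \<otimes> c"])
  next
    fix r m assume r: "r \<in> carrier R" and "m \<in> torsion_part R M"
    then obtain b where *: "m \<in> carrier M" "b \<in> carrier R" "b \<noteq> \<zero>" "b \<odot>\<^bsub>M\<^esub> m = \<zero>\<^bsub>M\<^esub>"
      by (auto simp: torsion_part_def)
    \<comment> \<open>The same \<open>b\<close> kills \<open>r m\<close>, since
      \<open>b (r m) = (b r) m\<close> vanishes by IFP.\<close>
    then show "r \<odot>\<^bsub>M\<^esub> m \<in> torsion_part R M"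
      using ifp[of b r m] r smult_closed
      by (auto simp: torsion_part_def smult_assoc1 intro!: bexI[of _ b])
  qed
qed

text \<open>If \<open>b\<close> kills \<open>a m\<close>, then \<open>b a\<close> kills
  \<open>m\<close>, and \<open>b a\<close> is nonzero whenever \<open>a\<close> is. This is what
  makes the quotient by the torsion part torsion-free.\<close>

lemma torsion_part_closed:
  fixes R :: "'r ring" (structure) and M :: "('r, 'm) module" (structure)
  assumes "left_module R M" and "no_zero_divisors R"
    and "a \<in> carrier R" "m \<in> carrier M" "a \<odot>\<^bsub>M\<^esub> m \<in> torsion_part R M"
  shows "a = \<zero> \<or> m \<in> torsion_part R M"
proof -
  interpret left_module R M by (rule assms)
  obtain b where b: "b \<in> carrier R" "b \<noteq> \<zero>" "b \<odot>\<^bsub>M\<^esub> (a \<odot>\<^bsub>M\<^esub> m) = \<zero>\<^bsub>M\<^esub>"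
    using assms by (auto simp: torsion_part_def)
  then have "(b \<otimes> a) \<odot>\<^bsub>M\<^esub> m = \<zero>\<^bsub>M\<^esub>" using assms by (simp add: smult_assoc1)
  moreover have "b \<otimes> a \<noteq> \<zero>" if "a \<noteq> \<zero>"
    using assms(2,3) b that by (auto simp: no_zero_divisors_def)
  ultimately show ?thesis
    using assms b by (auto simp: torsion_part_def)
qed


section \<open>The radical\<close>

text \<open>Every submodule in the intersection contains the torsion part, because it contains 0 and
  its quotient has no torsion. If the torsion part is proper, it takes part in the intersection
  itself and is the smallest member.\<close>

lemma beta_cof_eq_torsion_part:
  fixes R :: "'r ring" (structure) and M :: "('r, 'm) module" (structure)
  assumes "ifp_module R M" and "no_zero_divisors R"
  shows "beta_cof R M = torsion_part R M"
proof -
  note lm = ifp_moduleD(1)[OF assms(1)]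
  interpret left_module R M by (rule lm)
  let ?T = "torsion_part R M"
  define \<N> where "\<N> = {N. submodule N R M \<and> faithful_completely_prime R (quot_module M N)}"
  have beta: "beta_cof R M = (if \<N> = {} then carrier M else \<Inter>\<N>)"
    unfolding beta_cof_def \<N>_def Let_def ..
  have sub: "?T \<subseteq> N" if "N \<in> \<N>" for N
  proof -
    have N: "submodule N R M" "faithful_completely_prime R (quot_module M N)"
      using that by (auto simp: \<N>_def)
    then show ?thesis
      using submoduleD(2)[OF N(1)] faithful_completely_prime_quot_iff[OF lm N(1)]
      by (auto simp: torsion_part_def)
  qed
  have T: "?T \<in> \<N> \<longleftrightarrow> ?T \<noteq> carrier M"
    using submodule_torsion_part[OF assms] torsion_part_closed[OF lm assms(2)]
    by (auto simp: \<N>_def faithful_completely_prime_quot_iff[OF lm])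
  show ?thesis
  proof (cases "?T = carrier M")
    case True
    \<comment> \<open>A member of the family would be all of \<open>M\<close>, whose quotient is
      zero and does not qualify. The family is therefore empty and the default value
      \<open>carrier M\<close> applies.\<close>
    have "N = ?T" if "N \<in> \<N>" for N
      using sub[OF that] True submoduleD(1)[of N] that by (auto simp: \<N>_def)
    with True T have "\<N> = {}" by blast
    with True beta show ?thesis by simp
  next
    case False
    with sub T beta show ?thesis by auto
  qed
qed

text \<open>By \<open>faithful_completely_prime_no_zero_divisors\<close> no quotient qualifies, so
  the radical takes its default value.\<close>

lemma beta_cof_eq_carrier:
  assumes "\<not> no_zero_divisors R"
  shows "beta_cof R M = carrier M"
  using assms faithful_completely_prime_no_zero_divisors by (auto simp: beta_cof_def Let_def)

lemma submodule_beta_cof: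
  assumes "ifp_module R M"
  shows "submodule (beta_cof R M) R M"
proof (cases "no_zero_divisors R")
  case True
  with assms show ?thesis by (simp add: beta_cof_eq_torsion_part submodule_torsion_part)
next
  case False
  interpret left_module R M by (rule ifp_moduleD[OF assms])
  show ?thesis
    using False by (auto simp: beta_cof_eq_carrier smult_closed intro!: submoduleI)
qed

text \<open>Whether an element is torsion depends only on its scalar multiples and on 0, which
  \<open>N\<close> shares with \<open>M\<close>. If \<open>R\<close> is not a domain, the claim is
  just that \<open>N\<close> is its own intersection with \<open>carrier M\<close>.\<close>

lemma beta_cof_hereditary:
  assumes "ifp_module R M" and "submodule N R M"
  shows "beta_cof R (submod M N) = N \<inter> beta_cof R M"
proof -
  interpret left_module R M by (rule ifp_moduleD[OF assms(1)])
  note N = submoduleD(1)[OF assms(2)]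
  show ?thesis
    using N assms ifp_module_submod[OF assms]
    by (cases "no_zero_divisors R")
      (auto simp: beta_cof_eq_torsion_part beta_cof_eq_carrier torsion_part_def)
qed

lemma beta_cof_idempotent:
  assumes "ifp_module R M"
  shows "beta_cof R (submod M (beta_cof R M)) = beta_cof R M"
  using beta_cof_hereditary[OF assms submodule_beta_cof[OF assms]] by simp

text \<open>The torsion part of \<open>M\<close> meets \<open>N\<close> in the torsion part of
  \<open>N\<close>, which is zero; by essentiality it is zero itself.\<close>

lemma faithful_completely_prime_essential_extension:
  fixes R :: "'r ring" (structure) and M :: "('r, 'm) module" (structure)
  assumes "ifp_module R M" and "essential_submodule N R M"
    and "faithful_completely_prime R (submod M N)"
  shows "faithful_completely_prime R M"
proof -
  note lm = ifp_moduleD(1)[OF assms(1)]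
  interpret left_module R M by (rule lm)
  have N: "submodule N R M"
    and ess: "\<And>K. \<lbrakk>submodule K R M; K \<noteq> {\<zero>\<^bsub>M\<^esub>}\<rbrakk> \<Longrightarrow> N \<inter> K \<noteq> {\<zero>\<^bsub>M\<^esub>}"
    using assms(2) by (auto simp: essential_submodule_def)
  \<comment> \<open>This is extracted from \<open>N\<close>; it makes the torsion part of
    \<open>M\<close> a submodule, to which essentiality can be applied.\<close>
  have nzd: "no_zero_divisors R"
    by (rule faithful_completely_prime_no_zero_divisors[OF assms(3)])
  have fcp: "N \<noteq> {\<zero>\<^bsub>M\<^esub>}" "torsion_part R (submod M N) \<subseteq> {\<zero>\<^bsub>M\<^esub>}"
    using assms(3) by (auto simp: faithful_completely_prime_iff[OF left_module_submod[OF N]])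
  have T: "submodule (torsion_part R M) R M"
    by (rule submodule_torsion_part[OF assms(1) nzd])
  have "N \<inter> torsion_part R M = {\<zero>\<^bsub>M\<^esub>}"
    using fcp(2) submoduleD(2)[OF N] submoduleD(2)[OF T] by (auto simp: torsion_part_def)
  then have "torsion_part R M = {\<zero>\<^bsub>M\<^esub>}" using ess[OF T] by blast
  moreover have "carrier M \<noteq> {\<zero>\<^bsub>M\<^esub>}"
    using fcp(1) submoduleD(1,2)[OF N] by blast
  ultimately show ?thesis by (simp add: faithful_completely_prime_iff[OF lm])
qed


section \<open>The torsion theory\<close>

lemma Hom_trivialI:
  assumes "left_module R M" and "left_module R N"
    and "\<And>h x. \<lbrakk>h \<in> Hom R M N; x \<in> carrier M\<rbrakk> \<Longrightarrow> h x = \<zero>\<^bsub>N\<^esub>"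
  shows "Hom_trivial R M N"
proof -
  interpret M: left_module R M by (rule assms)
  interpret N: left_module R N by (rule assms)
  have "(\<lambda>x\<in>carrier M. \<zero>\<^bsub>N\<^esub>) \<in> Hom R M N"
    by (auto simp: Hom_def M.smult_closed N.smult_r_null)
  moreover have "h = (\<lambda>x\<in>carrier M. \<zero>\<^bsub>N\<^esub>)" if "h \<in> Hom R M N" for h
    using assms(3)[OF that] that by (auto simp: Hom_def intro!: PiE_ext)
  ultimately show ?thesis unfolding Hom_trivial_def by blast
qed

lemma Hom_trivialD:
  assumes "Hom_trivial R M N" and "h \<in> Hom R M N" and "x \<in> carrier M"
  shows "h x = \<zero>\<^bsub>N\<^esub>"
  using assms by (auto simp: Hom_trivial_def)

lemma Hom_zero:
  assumes "left_module R M" and "left_module R N" and "h \<in> Hom R M N"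
  shows "h \<zero>\<^bsub>M\<^esub> = \<zero>\<^bsub>N\<^esub>"
proof -
  interpret M: left_module R M by (rule assms)
  interpret N: left_module R N by (rule assms)
  have "h \<zero>\<^bsub>M\<^esub> \<oplus>\<^bsub>N\<^esub> h \<zero>\<^bsub>M\<^esub> = h \<zero>\<^bsub>M\<^esub>" "h \<zero>\<^bsub>M\<^esub> \<in> carrier N"
    using assms(3) M.zero_closed by (auto simp: Hom_def) (metis M.r_zero M.zero_closed)
  then show ?thesis by (metis N.add.r_cancel_one')
qed

text \<open>A scalar that kills \<open>x\<close> also kills \<open>h x\<close>, so torsion elements
  go to torsion elements, and 0 is the only one in \<open>F\<close>. If \<open>R\<close> is not a
  domain, the radical of \<open>F\<close> is all of \<open>F\<close>, so \<open>F\<close> is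
  zero.\<close>

lemma Hom_trivial_torsion:
  assumes "T \<in> torsion_class R" and "F \<in> torsion_free_class R"
  shows "Hom_trivial R T F"
proof (rule Hom_trivialI)
  have ifp: "ifp_module R T" "ifp_module R F"
    using assms by (auto simp: torsion_class_def torsion_free_class_def)
  note lm = ifp[THEN ifp_moduleD(1)]
  then show "left_module R T" "left_module R F" .
  fix h x assume h: "h \<in> Hom R T F" and x: "x \<in> carrier T"
  then have hx: "h x \<in> carrier F" by (auto simp: Hom_def)
  show "h x = \<zero>\<^bsub>F\<^esub>"
  proof (cases "no_zero_divisors R")
    case True
    with assms ifp x obtain a where a: "a \<in> carrier R" "a \<noteq> \<zero>\<^bsub>R\<^esub>" "a \<odot>\<^bsub>T\<^esub> x = \<zero>\<^bsub>T\<^esub>"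
      by (auto simp: torsion_class_def beta_cof_eq_torsion_part torsion_part_def)
    \<comment> \<open>The zero of \<open>T\<close> is rewritten as \<open>a x\<close>, so that
      linearity of \<open>h\<close> applies.\<close>
    then have "a \<odot>\<^bsub>F\<^esub> h x = h \<zero>\<^bsub>T\<^esub>"
      using h x by (simp add: Hom_def flip: a(3))
    then have "h x \<in> torsion_part R F"
      using a hx Hom_zero[OF lm h] by (auto simp: torsion_part_def)
    with assms(2) ifp True show ?thesis
      by (simp add: torsion_free_class_def beta_cof_eq_torsion_part)
  next
    case False
    with assms(2) hx show ?thesis
      by (simp add: torsion_free_class_def beta_cof_eq_carrier)
  qed
qed

text \<open>The quotient by the torsion part has carrier type \<open>'m set\<close>; to stay within the class of
  modules over \<open>'m\<close>, it is copied onto a system of coset representatives.\<close>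

lemma torsion_classI:
  fixes R :: "'r ring" (structure) and M :: "('r, 'm) module" (structure)
  assumes ifp: "ifp_module R M"
    and hom: "\<And>F :: ('r, 'm) module. F \<in> torsion_free_class R \<Longrightarrow> Hom_trivial R M F"
  shows "M \<in> torsion_class R"
proof (cases "no_zero_divisors R")
  case False
  with ifp show ?thesis by (simp add: torsion_class_def beta_cof_eq_carrier)
next
  case True
  note lm = ifp_moduleD(1)[OF ifp]
  interpret left_module R M by (rule lm)
  define T where "T = torsion_part R M"
  have subT: "submodule T R M"
    unfolding T_def by (rule submodule_torsion_part[OF ifp True])
  interpret T: abelian_subgroup T M by (rule submodule_abelian_subgroup[OF subT])
  note T = submoduleD[OF subT]
  \<comment> \<open>The choice is made from the coset as a set, so \<open>f x\<close> depends only
    on the coset of \<open>x\<close>. \<open>F\<close> carries the quotient structure on the chosen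
    elements, with \<open>f\<close> as the projection.\<close>
  define f where "f x = (SOME y. y \<in> T +>\<^bsub>M\<^esub> x)" for x
  define F :: "('r, 'm) module" where
    "F = \<lparr>carrier = f ` carrier M, mult = undefined, one = undefined, zero = f \<zero>\<^bsub>M\<^esub>,
          add = (\<lambda>x y. f (x \<oplus>\<^bsub>M\<^esub> y)), smult = (\<lambda>a x. f (a \<odot>\<^bsub>M\<^esub> x))\<rparr>"
  have mem: "f x \<in> T +>\<^bsub>M\<^esub> x" if "x \<in> carrier M" for x
    unfolding f_def using T.a_rcos_self[OF that] by (rule someI)
  have dec: "\<exists>t\<in>T. f x = t \<oplus>\<^bsub>M\<^esub> x" if "x \<in> carrier M" for x
    using mem[OF that] by (auto simp: a_r_coset_def')
  have eqI: "f (t \<oplus>\<^bsub>M\<^esub> x) = f x" if "t \<in> T" "x \<in> carrier M" for t x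
  proof -
    have "t \<oplus>\<^bsub>M\<^esub> x \<in> T +>\<^bsub>M\<^esub> x" using that by (auto simp: a_r_coset_def')
    then show ?thesis
      using T.a_repr_independence' that(2) unfolding f_def by metis
  qed
  have carrier: "carrier F = f ` carrier M" and zero: "\<zero>\<^bsub>F\<^esub> = f \<zero>\<^bsub>M\<^esub>"
    by (auto simp: F_def)
  have add: "f x \<oplus>\<^bsub>F\<^esub> f y = f (x \<oplus>\<^bsub>M\<^esub> y)" if xy: "x \<in> carrier M" "y \<in> carrier M" for x y
  proof -
    obtain s t where st: "s \<in> T" "f x = s \<oplus>\<^bsub>M\<^esub> x" "t \<in> T" "f y = t \<oplus>\<^bsub>M\<^esub> y"
      using dec xy by meson
    have "s \<in> carrier M" "t \<in> carrier M" using st T(1) by auto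
    \<comment> \<open>Passing to representatives changes the sum only by an element of
      \<open>T\<close>, which \<open>f\<close> does not see.\<close>
    then have "f x \<oplus>\<^bsub>M\<^esub> f y = (s \<oplus>\<^bsub>M\<^esub> t) \<oplus>\<^bsub>M\<^esub> (x \<oplus>\<^bsub>M\<^esub> y)"
      using st xy by (simp add: M.a_ac)
    then show ?thesis using eqI[of "s \<oplus>\<^bsub>M\<^esub> t"] st xy by (simp add: F_def)
  qed
  have smult: "a \<odot>\<^bsub>F\<^esub> f x = f (a \<odot>\<^bsub>M\<^esub> x)" if ax: "a \<in> carrier R" "x \<in> carrier M" for a x
  proof -
    obtain t where t: "t \<in> T" "f x = t \<oplus>\<^bsub>M\<^esub> x" using dec ax by meson
    then have "a \<odot>\<^bsub>M\<^esub> f x = a \<odot>\<^bsub>M\<^esub> t \<oplus>\<^bsub>M\<^esub> a \<odot>\<^bsub>M\<^esub> x"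
      using ax T(1) by (auto simp: smult_r_distr)
    then show ?thesis using eqI T(5) t ax smult_closed by (simp add: F_def)
  qed
  have ker: "f x = \<zero>\<^bsub>F\<^esub> \<longleftrightarrow> x \<in> T" if x: "x \<in> carrier M" for x
  proof
    assume "f x = \<zero>\<^bsub>F\<^esub>"
    \<comment> \<open>The representative of 0 lies in the coset of 0, which is
      \<open>T\<close>.\<close>
    then have "f x \<in> T" using mem[OF M.zero_closed] T(1) zero by simp
    moreover obtain t where t: "t \<in> T" "f x = t \<oplus>\<^bsub>M\<^esub> x" using dec x by meson
    ultimately have "\<ominus>\<^bsub>M\<^esub> t \<oplus>\<^bsub>M\<^esub> (t \<oplus>\<^bsub>M\<^esub> x) \<in> T" using T by simp
    moreover have "t \<in> carrier M" using t T(1) by auto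
    ultimately show "x \<in> T" using x by (simp add: M.r_neg1)
  next
    assume "x \<in> T"
    then show "f x = \<zero>\<^bsub>F\<^esub>" using eqI[of x "\<zero>\<^bsub>M\<^esub>"] x zero by simp
  qed
  have lmF: "left_module R F" by (rule left_module_image[OF carrier zero add smult])
  then interpret F: left_module R F .
  have tf: "torsion_part R F \<subseteq> {\<zero>\<^bsub>F\<^esub>}"
    using torsion_part_image[OF lm carrier smult ker] torsion_part_closed[OF lm True]
    unfolding T_def by blast
  \<comment> \<open>IFP is not inherited from \<open>M\<close> here but follows from
    torsion-freeness: \<open>a m = 0\<close> leaves only \<open>a = 0\<close> or
    \<open>m = 0\<close>.\<close>
  have "ifp_module R F"
    unfolding ifp_module_def
  proof (intro conjI lmF ballI impI)
    fix a m r assume *: "a \<in> carrier R" "m \<in> carrier F" "a \<odot>\<^bsub>F\<^esub> m = \<zero>\<^bsub>F\<^esub>" "r \<in> carrier R"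
    then have "a = \<zero> \<or> m = \<zero>\<^bsub>F\<^esub>" using tf by (auto simp: torsion_part_def)
    then show "(a \<otimes> r) \<odot>\<^bsub>F\<^esub> m = \<zero>\<^bsub>F\<^esub>"
      using * F.smult_l_null F.smult_r_null by auto
  qed
  moreover from this have "torsion_part R F = {\<zero>\<^bsub>F\<^esub>}"
    using tf F.submoduleD(2)[OF submodule_torsion_part[OF _ True]] by blast
  ultimately have "F \<in> torsion_free_class R"
    using True by (simp add: torsion_free_class_def beta_cof_eq_torsion_part)
  \<comment> \<open>The projection is the test homomorphism: by assumption it vanishes, so its
    kernel \<open>T\<close> is all of \<open>M\<close>.\<close>
  moreover have "(\<lambda>x\<in>carrier M. f x) \<in> Hom R M F"
    using carrier add smult smult_closed by (auto simp: Hom_def)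
  ultimately have "f x = \<zero>\<^bsub>F\<^esub>" if "x \<in> carrier M" for x
    using Hom_trivialD[OF hom] that by fastforce
  then have "T = carrier M" using ker T(1) by blast
  then show ?thesis
    using ifp True by (simp add: torsion_class_def beta_cof_eq_torsion_part T_def)
qed

text \<open>The radical of \<open>M\<close>, taken as a module, is torsion by idempotence, so its
  inclusion into \<open>M\<close> has to vanish.\<close>

lemma torsion_free_classI:
  fixes R :: "'r ring" (structure) and M :: "('r, 'm) module" (structure)
  assumes ifp: "ifp_module R M"
    and hom: "\<And>T :: ('r, 'm) module. T \<in> torsion_class R \<Longrightarrow> Hom_trivial R T M"
  shows "M \<in> torsion_free_class R"
proof -
  let ?B = "beta_cof R M"
  interpret left_module R M by (rule ifp_moduleD[OF ifp])
  note sub = submodule_beta_cof[OF ifp]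
  note B = submoduleD[OF sub]
  have "submod M ?B \<in> torsion_class R"
    using ifp_module_submod[OF ifp sub] beta_cof_idempotent[OF ifp]
    by (simp add: torsion_class_def)
  moreover have "(\<lambda>x\<in>?B. x) \<in> Hom R (submod M ?B) M"
    using B by (auto simp: Hom_def)
  ultimately have "x = \<zero>\<^bsub>M\<^esub>" if "x \<in> ?B" for x
    using Hom_trivialD[OF hom] that by fastforce
  then have "?B = {\<zero>\<^bsub>M\<^esub>}" using B(2) by blast
  then show ?thesis using ifp by (simp add: torsion_free_class_def)
qed

lemma torsion_theory_beta_cof:
  "torsion_theory R {M. ifp_module R M} (torsion_class R) (torsion_free_class R)"
  unfolding torsion_theory_def
proof (intro conjI ballI impI)
  show "torsion_class R \<subseteq> {M. ifp_module R M}" "torsion_free_class R \<subseteq> {M. ifp_module R M}"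
    by (auto simp: torsion_class_def torsion_free_class_def)
qed (auto intro: Hom_trivial_torsion torsion_classI torsion_free_classI)

theorem theorem5p1:
  fixes R :: "'r ring"
  assumes "ring R"
  shows
    "(\<forall>(M :: ('r, 'm) module) N.
        ifp_module R M \<and> essential_submodule N R M \<and> faithful_completely_prime R (submod M N)
        \<longrightarrow> faithful_completely_prime R M) \<and>
     (\<forall>(M :: ('r, 'm) module) N.
        ifp_module R M \<and> submodule N R M
        \<longrightarrow> beta_cof R (submod M N) = N \<inter> beta_cof R M) \<and>
     torsion_theory R {M :: ('r, 'm) module. ifp_module R M}
        (torsion_class R) (torsion_free_class R) \<and>
     (\<forall>M :: ('r, 'm) module. ifp_module R M
        \<longrightarrow> beta_cof R (submod M (beta_cof R M)) = beta_cof R M)"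
proof (intro conjI allI impI; (elim conjE)?)
  fix M :: "('r, 'm) module" and N
  assume "ifp_module R M" "essential_submodule N R M" "faithful_completely_prime R (submod M N)"
  then show "faithful_completely_prime R M"
    by (rule faithful_completely_prime_essential_extension)
qed (rule beta_cof_hereditary torsion_theory_beta_cof beta_cof_idempotent; assumption)+

end
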